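(* Let $M\ge1$ and let ${\bf T}=\{\tau_1,\dots,\tau_N\}$ be a sporadic task set with constrained deadlines ($D_i\le T_i$ for all $i$), indexed so that $D_1\le\cdots\le D_N$. Run the deadline-monotonic partitioning algorithm on ${\bf T}$ with $M$ unit-speed processors, any fitting strategy, and the time-demand-analysis test: $\tau_k$ can be added to processor $m$ holding ${\bf T}_m$ iff there exists $t$ with $0<t\le D_k$ and $C_k+\sum_{\tau_i\in{\bf T}_m}\lceil t/T_i\rceil C_i\le t$. Then the algorithm has speedup factor $\frac{1}{W(0.5)}\approx 2.84306$: whenever it returns failure on ${\bf T}$, the task set cannot be feasibly scheduled by any preemptive multiprocessor scheduling algorithm on $M$ identical processors each of speed $W(0.5)$.
   Context: $W$ denotes the Lambert W function: $W(z)$ is the unique real solution $w\ge 0$ of $z=we^{w}$ for $z\ge 0$. A sporadic task $\tau_i=(C_i,T_i,D_i)$ has worst-case execution time $C_i>0$, minimum inter-arrival time $T_i>0$, relative deadline $D_i>0$; consecutive job releases are at least $T_i$ apart and each job must complete within $D_i$ of its release; on a processor of speed $s$ a job needs $C_i/s$ time. Deadline-monotonic partitioning algorithm: tasks indexed by non-decreasing relative deadline; ${\bf T}_1=\{\tau_1\}$, ${\bf T}_m=\emptyset$ for $m\ge2$; for $k=2,\dots,N$, if some processor $m$ has ${\bf T}_m\cup\{\tau_k\}$ passing the test, choose one such $m$ by the fitting strategy (any rule) and add $\tau_k$ to ${\bf T}_m$, else return failure. Each processor runs preemptive deadline-monotonic scheduling. A feasible schedule means every job of every legal sporadic arrival sequence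 meets its deadline. *)

theory Defs
  imports "HOL-Analysis.Analysis"
begin

definition lambert_W :: "real \<Rightarrow> real" where
  "lambert_W z = (THE w. 0 \<le> w \<and> z = w * exp w)"

datatype task = Task (wcet: real) (period: real) (deadline: real)

text \<open>A task set is a family \<open>\<tau>\<close> used at the indices \<open>{1..N}\<close>, so that several tasks may
  have the same parameters.\<close>

definition sporadic_task_set :: "nat \<Rightarrow> (nat \<Rightarrow> task) \<Rightarrow> bool" where
  "sporadic_task_set N \<tau> \<longleftrightarrow>
     (\<forall>i\<in>{1..N}. 0 < wcet (\<tau> i) \<and> 0 < period (\<tau> i) \<and> 0 < deadline (\<tau> i))"

definition constrained_deadlines :: "nat \<Rightarrow> (nat \<Rightarrow> task) \<Rightarrow> bool" where
  "constrained_deadlines N \<tau> \<longleftrightarrow> (\<forall>i\<in>{1..N}. deadline (\<tau> i) \<le> period (\<tau> i))"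

definition deadline_monotonic_indexing :: "nat \<Rightarrow> (nat \<Rightarrow> task) \<Rightarrow> bool" where
  "deadline_monotonic_indexing N \<tau> \<longleftrightarrow>
     (\<forall>i\<in>{1..N}. \<forall>j\<in>{1..N}. i \<le> j \<longrightarrow> deadline (\<tau> i) \<le> deadline (\<tau> j))"

text \<open>A partition maps each processor to the set of indices of the tasks it holds. A fitting
  strategy sees the current partition, the index of the task to be placed, and the set of
  processors that pass the test, and selects one of the latter.\<close>

type_synonym partition = "nat \<Rightarrow> nat set"
type_synonym strategy = "partition \<Rightarrow> nat \<Rightarrow> nat set \<Rightarrow> nat"

definition fitting_strategy :: "strategy \<Rightarrow> bool" where
  "fitting_strategy fit \<longleftrightarrow> (\<forall>P k A. A \<noteq> {} \<longrightarrow> fit P k A \<in> A)"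

text \<open>\<open>dm_partition M test fit k\<close> is the result after the tasks \<open>1, \<dots>, k\<close> have been treated on the
  processors \<open>{1..M}\<close>, with \<open>None\<close> for failure. The first task is placed without being tested.\<close>

fun dm_partition :: "nat \<Rightarrow> (nat set \<Rightarrow> nat \<Rightarrow> bool) \<Rightarrow> strategy \<Rightarrow> nat \<Rightarrow> partition option" where
  "dm_partition M test fit 0 = Some (\<lambda>_. {})"
| "dm_partition M test fit (Suc 0) = Some ((\<lambda>_. {})(1 := {1}))"
| "dm_partition M test fit (Suc (Suc k)) =
     (case dm_partition M test fit (Suc k) of
        None \<Rightarrow> None
      | Some P \<Rightarrow>
          (let k' = Suc (Suc k); A = {m \<in> {1..M}. test (P m) k'}
           in if A = {} then None
              else let m = fit P k' A in Some (P(m := insert k' (P m)))))"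

definition tda_test :: "(nat \<Rightarrow> task) \<Rightarrow> nat set \<Rightarrow> nat \<Rightarrow> bool" where
  "tda_test \<tau> S k \<longleftrightarrow>
     (\<exists>t. 0 < t \<and> t \<le> deadline (\<tau> k) \<and>
       wcet (\<tau> k) + (\<Sum>i\<in>S. real_of_int \<lceil>t / period (\<tau> i)\<rceil> * wcet (\<tau> i)) \<le> t)"

text \<open>An arrival sequence gives for each task its set of release times, which may be finite or
  infinite. The job of task \<open>i\<close> released at time \<open>r\<close> is the pair \<open>(i, r)\<close>; as periods are
  positive, a task never releases two jobs at the same time.\<close>

type_synonym arrivals = "nat \<Rightarrow> real set"
type_synonym job = "nat \<times> real"

definition legal_arrivals :: "nat \<Rightarrow> (nat \<Rightarrow> task) \<Rightarrow> arrivals \<Rightarrow> bool" where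
  "legal_arrivals N \<tau> arr \<longleftrightarrow>
     (\<forall>i\<in>{1..N}. arr i \<subseteq> {0..} \<and>
        (\<forall>r\<in>arr i. \<forall>r'\<in>arr i. r < r' \<longrightarrow> period (\<tau> i) \<le> r' - r))"

definition jobs :: "nat \<Rightarrow> arrivals \<Rightarrow> job set" where
  "jobs N arr = (SIGMA i:{1..N}. arr i)"

text \<open>\<open>\<sigma> t m\<close> is the job that processor \<open>m\<close> executes at time \<open>t\<close>, if any. Jobs may be preempted
  and may migrate between processors at any time, but a job never runs on two processors at
  once. Measurability makes the execution time of a job on a processor meaningful and is
  more liberal than allowing finitely many preemptions per time interval.\<close>

type_synonym schedule = "real \<Rightarrow> nat \<Rightarrow> job option"

definition valid_schedule :: "nat \<Rightarrow> nat \<Rightarrow> arrivals \<Rightarrow> schedule \<Rightarrow> bool" where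
  "valid_schedule M N arr \<sigma> \<longleftrightarrow>
     (\<forall>t. \<forall>m\<in>{1..M}. \<forall>i r. \<sigma> t m = Some (i, r) \<longrightarrow> (i, r) \<in> jobs N arr \<and> r \<le> t) \<and>
     (\<forall>t. \<forall>m\<in>{1..M}. \<forall>m'\<in>{1..M}. \<forall>J. \<sigma> t m = Some J \<and> \<sigma> t m' = Some J \<longrightarrow> m = m') \<and>
     (\<forall>m\<in>{1..M}. \<forall>J. {t. \<sigma> t m = Some J} \<in> sets lebesgue)"

definition execution_time :: "nat \<Rightarrow> schedule \<Rightarrow> job \<Rightarrow> real \<Rightarrow> real \<Rightarrow> real" where
  "execution_time M \<sigma> J a b = (\<Sum>m\<in>{1..M}. measure lebesgue {t \<in> {a..b}. \<sigma> t m = Some J})"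

definition meets_all_deadlines ::
    "nat \<Rightarrow> real \<Rightarrow> nat \<Rightarrow> (nat \<Rightarrow> task) \<Rightarrow> arrivals \<Rightarrow> schedule \<Rightarrow> bool" where
  "meets_all_deadlines M s N \<tau> arr \<sigma> \<longleftrightarrow>
     (\<forall>(i, r)\<in>jobs N arr.
        wcet (\<tau> i) / s \<le> execution_time M \<sigma> (i, r) r (r + deadline (\<tau> i)))"

text \<open>A scheduling algorithm is any map from arrival sequences to schedules. This includes the
  online algorithms, whose decisions depend on past arrivals only, as well as clairvoyant
  ones.\<close>

definition feasible :: "nat \<Rightarrow> real \<Rightarrow> nat \<Rightarrow> (nat \<Rightarrow> task) \<Rightarrow> bool" where
  "feasible M s N \<tau> \<longleftrightarrow>
     (\<exists>alg :: arrivals \<Rightarrow> schedule. \<forall>arr. legal_arrivals N \<tau> arr \<longrightarrow>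
        valid_schedule M N arr (alg arr) \<and> meets_all_deadlines M s N \<tau> arr (alg arr))"

end

theory Submission
  imports Defs
begin

text \<open>Suppose that \<open>\<tau>\<^sub>k\<close> is rejected, let \<open>D\<close> be its deadline and \<open>n\<^sub>i = max 1 (\<lceil>D / T\<^sub>i\<rceil> - 1)\<close>.
  If \<open>\<tau>\<^sub>i\<close> releases periodically from time 0, its first \<open>n\<^sub>i\<close> jobs have to be finished by time \<open>D\<close>.
  On a processor holding \<open>S\<close> put \<open>Q = C\<^sub>k + (\<Sum>i\<in>S. n\<^sub>i C\<^sub>i)\<close>. Evaluating the failed test at \<open>D\<close> and
  at the instants \<open>n\<^sub>i T\<^sub>i < D\<close> yields \<open>D < Q (\<Prod>i\<in>S. 1 + U\<^sub>i)\<close>, hence \<open>D exp (- (\<Sum>i\<in>S. U\<^sub>i)) < Q\<close>.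
  If the task set were feasible at speed \<open>s\<close>, then \<open>C\<^sub>k \<le> s D\<close>, the demand up to \<open>D\<close> would be at
  most \<open>M s D\<close>, and the total utilization would be at most \<open>M s\<close>. Summing over the processors and
  using convexity of \<open>exp\<close> gives \<open>exp (- s) < 2 s\<close>, which is false for \<open>s = W(1/2)\<close>.\<close>

section \<open>The value of the Lambert function at one half\<close>

lemma mult_exp_strict_mono:
  fixes x y :: real
  assumes "0 \<le> x" "x < y"
  shows "x * exp x < y * exp y"
  using assms by (intro mult_strict_mono) auto

lemma lambert_W_eqI:
  assumes "0 \<le> w" "w * exp w = z"
  shows "lambert_W z = w"
  unfolding lambert_W_def
proof (rule the_equality)
  show "0 \<le> w \<and> z = w * exp w" using assms by simp
next
  fix v assume "0 \<le> v \<and> z = v * exp v"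
  then show "v = w"
    using mult_exp_strict_mono[of v w] mult_exp_strict_mono[of w v] assms
    by (cases v w rule: linorder_cases) auto
qed

text \<open>Maclaurin expansion with Lagrange remainder \<open>exp t * x^8 / 8!\<close>. For
  \<open>x\<close> in the unit interval \<open>0 < exp t \<le> exp 1 \<le> 3\<close>, and
  \<open>3 / 8! = 1 / 13440\<close>.\<close>

lemma exp_Taylor7_bounds:
  fixes x :: real
  assumes "0 \<le> x" "x \<le> 1"
  defines "p \<equiv> 1 + x + x^2/2 + x^3/6 + x^4/24 + x^5/120 + x^6/720 + x^7/5040"
  shows "p \<le> exp x" "exp x \<le> p + x^8/13440"
proof -
  obtain t where t: "\<bar>t\<bar> \<le> \<bar>x\<bar>" "exp x = (\<Sum>m<8. x ^ m / fact m) + exp t / fact 8 * x ^ 8"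
    using Maclaurin_exp_le[of x 8] by auto
  have "(\<Sum>m<8. x ^ m / fact m) = p"
    unfolding p_def by (simp add: fact_numeral numeral_eq_Suc lessThan_Suc)
  with t(2) have eq: "exp x = p + exp t * (x ^ 8 / 40320)" by (simp add: fact_numeral)
  have "exp t \<le> exp 1" using t(1) assms(1,2) by simp
  also have "\<dots> \<le> 3" by (rule exp_le)
  finally have "exp t * (x ^ 8 / 40320) \<le> 3 * (x ^ 8 / 40320)"
    using assms(1) by (intro mult_right_mono) auto
  with eq show "exp x \<le> p + x^8/13440" by simp
  show "p \<le> exp x" unfolding eq using assms(1) by simp
qed

lemma lambert_W_half:
  "lambert_W (1/2) * exp (lambert_W (1/2)) = 1/2"
  "0.3517334 \<le> lambert_W (1/2)"
  "lambert_W (1/2) \<le> 0.351734"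
proof -
  have lower: "0.3517334 * exp 0.3517334 \<le> (1/2 :: real)"
    using exp_Taylor7_bounds(2)[of "0.3517334"] by (simp add: power_divide)
  have upper: "(1/2 :: real) \<le> 0.351734 * exp 0.351734"
    using exp_Taylor7_bounds(1)[of "0.351734"] by (simp add: power_divide)
  \<comment> \<open>This bracket is narrow enough to place \<open>1 / w\<close> within
    \<open>5 / 10^6\<close> of 2.84306.\<close>
  obtain w :: real where w: "0.3517334 \<le> w" "w \<le> 0.351734" "w * exp w = 1/2"
    using IVT'[of "\<lambda>w::real. w * exp w" "0.3517334" "1/2" "0.351734"] lower upper
    by (force intro!: continuous_intros)
  have "lambert_W (1/2) = w" using w by (intro lambert_W_eqI) auto
  with w show "lambert_W (1/2) * exp (lambert_W (1/2)) = 1/2"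
    "0.3517334 \<le> lambert_W (1/2)" "lambert_W (1/2) \<le> 0.351734" by simp_all
qed

section \<open>Necessary conditions for feasibility\<close>

text \<open>Serves in two ways: with processors as indices, for one job, which never runs on two
  processors at once; and with jobs as indices, for one processor, which runs one job at a
  time.\<close>

lemma sum_measure_disjoint_le_interval:
  fixes A :: "'a \<Rightarrow> real set"
  assumes "finite I" "disjoint_family_on A I" "a \<le> b"
    and "\<And>i. i \<in> I \<Longrightarrow> A i \<in> sets lebesgue" "\<And>i. i \<in> I \<Longrightarrow> A i \<subseteq> {a..b}"
  shows "(\<Sum>i\<in>I. measure lebesgue (A i)) \<le> b - a"
proof -
  have lm: "A i \<in> lmeasurable" if "i \<in> I" for i
    using assms(4,5)[OF that] by (meson bounded_set_imp_lmeasurable bounded_closed_interval bounded_subset)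
  have "(\<Sum>i\<in>I. measure lebesgue (A i)) = measure lebesgue (\<Union>i\<in>I. A i)"
    using assms(1,2,4) fmeasurableD2[OF lm] by (intro measure_finite_Union[symmetric]) auto
  also have "\<dots> \<le> measure lebesgue {a..b}"
    using assms lm by (intro measure_mono_fmeasurable) auto
  finally show ?thesis using assms(3) by simp
qed

lemma valid_schedule_measurable:
  assumes "valid_schedule M N arr \<sigma>" "m \<in> {1..M}"
  shows "{t \<in> {a..b}. \<sigma> t m = Some J} \<in> sets lebesgue"
proof -
  have "{t. \<sigma> t m = Some J} \<in> sets lebesgue" using assms unfolding valid_schedule_def by blast
  then have "{a..b} \<inter> {t. \<sigma> t m = Some J} \<in> sets lebesgue" by (intro sets.Int) auto
  moreover have "{a..b} \<inter> {t. \<sigma> t m = Some J} = {t \<in> {a..b}. \<sigma> t m = Some J}" by auto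
  ultimately show ?thesis by simp
qed

lemma execution_time_le_length:
  assumes "valid_schedule M N arr \<sigma>" "a \<le> b"
  shows "execution_time M \<sigma> J a b \<le> b - a"
  unfolding execution_time_def
proof (rule sum_measure_disjoint_le_interval)
  show "disjoint_family_on (\<lambda>m. {t \<in> {a..b}. \<sigma> t m = Some J}) {1..M}"
    using assms(1) unfolding valid_schedule_def disjoint_family_on_def by blast
qed (use assms valid_schedule_measurable in auto)

lemma sum_execution_time_le:
  assumes "valid_schedule M N arr \<sigma>" "a \<le> b" "finite K"
  shows "(\<Sum>J\<in>K. execution_time M \<sigma> J a b) \<le> real M * (b - a)"
proof -
  have "(\<Sum>J\<in>K. execution_time M \<sigma> J a b)
      = (\<Sum>m\<in>{1..M}. \<Sum>J\<in>K. measure lebesgue {t \<in> {a..b}. \<sigma> t m = Some J})"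
    unfolding execution_time_def by (rule sum.swap)
  also have "\<dots> \<le> (\<Sum>m\<in>{1..M}. b - a)"
  proof (rule sum_mono, rule sum_measure_disjoint_le_interval)
    fix m J assume m: "m \<in> {1..M}"
    show "{t \<in> {a..b}. \<sigma> t m = Some J} \<in> sets lebesgue"
      by (rule valid_schedule_measurable[OF assms(1) m])
    show "disjoint_family_on (\<lambda>J. {t \<in> {a..b}. \<sigma> t m = Some J}) K"
      unfolding disjoint_family_on_def by force
  qed (use assms in auto)
  finally show ?thesis by simp
qed

lemma execution_time_mono:
  assumes "valid_schedule M N arr \<sigma>" "a' \<le> a" "b \<le> b'"
  shows "execution_time M \<sigma> J a b \<le> execution_time M \<sigma> J a' b'"
  unfolding execution_time_def
proof (rule sum_mono)
  fix m assume m: "m \<in> {1..M}"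
  have "{t \<in> {a'..b'}. \<sigma> t m = Some J} \<in> lmeasurable"
    using valid_schedule_measurable[OF assms(1) m]
    by (rule bounded_set_imp_lmeasurable[rotated]) (rule bounded_subset[of "{a'..b'}"], auto)
  then show "measure lebesgue {t \<in> {a..b}. \<sigma> t m = Some J}
      \<le> measure lebesgue {t \<in> {a'..b'}. \<sigma> t m = Some J}"
    using assms valid_schedule_measurable[OF assms(1) m]
    by (intro measure_mono_fmeasurable) auto
qed

text \<open>All tasks start together at time 0 and release as densely as is legal. This single
  sequence yields every necessary condition for feasibility used below.\<close>

definition periodic_arrivals :: "(nat \<Rightarrow> task) \<Rightarrow> arrivals" where
  "periodic_arrivals \<tau> i = range (\<lambda>j::nat. real j * period (\<tau> i))"

lemma legal_periodic_arrivals: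
  assumes "sporadic_task_set N \<tau>"
  shows "legal_arrivals N \<tau> (periodic_arrivals \<tau>)"
  unfolding legal_arrivals_def
proof (intro ballI conjI impI)
  fix i assume i: "i \<in> {1..N}"
  then have T: "0 < period (\<tau> i)" using assms by (auto simp: sporadic_task_set_def)
  then show "periodic_arrivals \<tau> i \<subseteq> {0..}" by (auto simp: periodic_arrivals_def)
  fix r r' assume "r \<in> periodic_arrivals \<tau> i" "r' \<in> periodic_arrivals \<tau> i" and less: "r < r'"
  then obtain j j' where r: "r = real j * period (\<tau> i)" "r' = real j' * period (\<tau> i)"
    by (auto simp: periodic_arrivals_def)
  then have "j < j'" using less T by simp
  then have "1 * period (\<tau> i) \<le> (real j' - real j) * period (\<tau> i)"
    using T by (intro mult_right_mono) auto
  then show "period (\<tau> i) \<le> r' - r" by (simp add: r algebra_simps)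
qed

text \<open>The job released at time 0 cannot run in parallel with itself, so it receives at most
  \<open>deadline (\<tau> i)\<close> units of time before its deadline.\<close>

lemma feasible_wcet_le:
  assumes "feasible M s N \<tau>" "sporadic_task_set N \<tau>" "0 < s" "i \<in> {1..N}"
  shows "wcet (\<tau> i) \<le> s * deadline (\<tau> i)"
proof -
  obtain \<sigma> where \<sigma>: "valid_schedule M N (periodic_arrivals \<tau>) \<sigma>"
      "meets_all_deadlines M s N \<tau> (periodic_arrivals \<tau>) \<sigma>"
    using assms(1) legal_periodic_arrivals[OF assms(2)] by (auto simp: feasible_def)
  have D: "0 < deadline (\<tau> i)" using assms by (auto simp: sporadic_task_set_def)
  have "(i, 0) \<in> jobs N (periodic_arrivals \<tau>)"
    using assms(4) by (auto simp: jobs_def periodic_arrivals_def image_iff intro: exI[of _ 0])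
  then have "wcet (\<tau> i) / s \<le> execution_time M \<sigma> (i, 0) 0 (0 + deadline (\<tau> i))"
    using \<sigma>(2) unfolding meets_all_deadlines_def by blast
  also have "\<dots> \<le> deadline (\<tau> i)" using execution_time_le_length[OF \<sigma>(1), of 0 "deadline (\<tau> i)"] D by simp
  finally show ?thesis using assms(3) by (simp add: field_simps)
qed

text \<open>The first \<open>n i\<close> periodic jobs of each task all have their deadlines by time
  \<open>L\<close>, and \<open>M\<close> processors supply at most \<open>M * L\<close> units of
  time until then. A task with \<open>n i = 0\<close> is left out of the count.\<close>

lemma feasible_demand_le:
  fixes n :: "nat \<Rightarrow> nat"
  assumes "feasible M s N \<tau>" "sporadic_task_set N \<tau>" "0 < s" "0 \<le> L"
    and n: "\<And>i. i \<in> {1..N} \<Longrightarrow> 0 < n i \<Longrightarrow> (real (n i) - 1) * period (\<tau> i) + deadline (\<tau> i) \<le> L"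
  shows "(\<Sum>i\<in>{1..N}. real (n i) * wcet (\<tau> i)) \<le> real M * s * L"
proof -
  let ?T = "\<lambda>i. period (\<tau> i)"
  let ?D = "\<lambda>i. deadline (\<tau> i)"
  obtain \<sigma> where \<sigma>: "valid_schedule M N (periodic_arrivals \<tau>) \<sigma>"
      "meets_all_deadlines M s N \<tau> (periodic_arrivals \<tau>) \<sigma>"
    using assms(1) legal_periodic_arrivals[OF assms(2)] by (auto simp: feasible_def)
  have T: "0 < ?T i" if "i \<in> {1..N}" for i
    using assms(2) that by (auto simp: sporadic_task_set_def)
  define I where "I = (SIGMA i:{1..N}. {..<n i})"
  define job_of where "job_of = (\<lambda>(i, j). (i, real j * ?T i))"
  have fin: "finite I" by (simp add: I_def)
  \<comment> \<open>Distinct indices give distinct jobs, so no execution time is counted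
    twice.\<close>
  have inj: "inj_on job_of I"
    using T by (fastforce simp: inj_on_def I_def job_of_def)
  have job: "wcet (\<tau> i) / s \<le> execution_time M \<sigma> (job_of (i, j)) 0 L" if ij: "(i, j) \<in> I" for i j
  proof -
    have i: "i \<in> {1..N}" and j: "j < n i" using ij by (auto simp: I_def)
    have "(i, real j * ?T i) \<in> jobs N (periodic_arrivals \<tau>)"
      using i by (auto simp: jobs_def periodic_arrivals_def)
    then have "wcet (\<tau> i) / s
        \<le> execution_time M \<sigma> (i, real j * ?T i) (real j * ?T i) (real j * ?T i + ?D i)"
      using \<sigma>(2) unfolding meets_all_deadlines_def by blast
    also have "\<dots> \<le> execution_time M \<sigma> (i, real j * ?T i) 0 L"
    proof (rule execution_time_mono[OF \<sigma>(1)])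
      show "0 \<le> real j * ?T i" using T[OF i] by simp
      have "real j * ?T i \<le> (real (n i) - 1) * ?T i"
        using T[OF i] j by (intro mult_right_mono) auto
      then show "real j * ?T i + ?D i \<le> L" using n[OF i] j by linarith
    qed
    finally show ?thesis by (simp add: job_of_def)
  qed
  have "(\<Sum>i\<in>{1..N}. real (n i) * wcet (\<tau> i)) / s = (\<Sum>i\<in>{1..N}. \<Sum>j\<in>{..<n i}. wcet (\<tau> i) / s)"
    by (simp add: sum_divide_distrib)
  also have "\<dots> = (\<Sum>(i, j)\<in>I. wcet (\<tau> i) / s)"
    unfolding I_def by (rule sum.Sigma) auto
  also have "\<dots> \<le> (\<Sum>x\<in>I. execution_time M \<sigma> (job_of x) 0 L)"
    by (rule sum_mono) (use job in auto)
  also have "\<dots> = (\<Sum>J\<in>job_of ` I. execution_time M \<sigma> J 0 L)"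
    using inj by (simp add: sum.reindex)
  also have "\<dots> \<le> real M * (L - 0)"
    using sum_execution_time_le[OF \<sigma>(1)] assms(4) fin by blast
  finally show ?thesis using assms(3) by (simp add: field_simps)
qed

text \<open>The demand up to \<open>L\<close> grows like \<open>L\<close> times the utilization, up
  to an error bounded by one job per task. Excess utilization would therefore overload the
  processors for large \<open>L\<close>.\<close>

lemma feasible_utilization_le:
  assumes "feasible M s N \<tau>" "sporadic_task_set N \<tau>" "constrained_deadlines N \<tau>" "0 < s"
  shows "(\<Sum>i\<in>{1..N}. wcet (\<tau> i) / period (\<tau> i)) \<le> real M * s"
proof (rule ccontr)
  let ?u = "\<Sum>i\<in>{1..N}. wcet (\<tau> i) / period (\<tau> i)"
  let ?C = "\<Sum>i\<in>{1..N}. wcet (\<tau> i)"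
  assume "\<not> ?u \<le> real M * s"
  then have gap: "0 < ?u - real M * s" by simp
  have bound: "L * (?u - real M * s) \<le> ?C" if L: "0 \<le> L" for L
  proof -
    \<comment> \<open>The number of whole periods in \<open>[0, L]\<close>. With constrained
      deadlines each of these jobs is due by the end of its period.\<close>
    define n where "n i = nat \<lfloor>L / period (\<tau> i)\<rfloor>" for i
    have n: "real (n i) \<le> L / period (\<tau> i)" "L / period (\<tau> i) - 1 \<le> real (n i)"
        "0 < wcet (\<tau> i)" "0 < period (\<tau> i)" "deadline (\<tau> i) \<le> period (\<tau> i)" if "i \<in> {1..N}" for i
    proof -
      show pos: "0 < wcet (\<tau> i)" "0 < period (\<tau> i)" "deadline (\<tau> i) \<le> period (\<tau> i)"
        using assms(2,3) that by (auto simp: sporadic_task_set_def constrained_deadlines_def)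
      have "0 \<le> L / period (\<tau> i)" using L pos by simp
      then show "real (n i) \<le> L / period (\<tau> i)" "L / period (\<tau> i) - 1 \<le> real (n i)"
        unfolding n_def by linarith+
    qed
    have "L * ?u - ?C = (\<Sum>i\<in>{1..N}. (L / period (\<tau> i) - 1) * wcet (\<tau> i))"
      by (simp add: sum_distrib_left sum_subtractf[symmetric] algebra_simps)
    also have "\<dots> \<le> (\<Sum>i\<in>{1..N}. real (n i) * wcet (\<tau> i))"
    proof (rule sum_mono)
      fix i assume i: "i \<in> {1..N}"
      show "(L / period (\<tau> i) - 1) * wcet (\<tau> i) \<le> real (n i) * wcet (\<tau> i)"
        using n(2,3)[OF i] by (intro mult_right_mono) auto
    qed
    also have "\<dots> \<le> real M * s * L"
    proof (rule feasible_demand_le[OF assms(1,2,4) L])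
      fix i assume i: "i \<in> {1..N}"
      have "real (n i) * period (\<tau> i) \<le> L" using n(1,4)[OF i] by (simp add: field_simps)
      then show "(real (n i) - 1) * period (\<tau> i) + deadline (\<tau> i) \<le> L"
        using n(5)[OF i] by (simp add: algebra_simps)
    qed
    finally show ?thesis by (simp add: algebra_simps)
  qed
  have C: "0 \<le> ?C"
    using assms(2) by (intro sum_nonneg) (auto simp: sporadic_task_set_def less_imp_le)
  \<comment> \<open>\<open>L\<close> is chosen so that the left side of \<open>bound\<close> becomes
    \<open>?C + 1\<close>.\<close>
  have "?C + 1 \<le> ?C"
    using bound[of "(?C + 1) / (?u - real M * s)"] gap C by simp
  then show False by simp
qed

section \<open>Failure of the time-demand test on one processor\<close>

text \<open>Remove an index \<open>j\<close> with the largest \<open>t j\<close>. The remaining sum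
  together with \<open>Q\<close> already bounds \<open>t j\<close>, so putting \<open>j\<close> back
  costs at most a factor \<open>1 + U j\<close>.\<close>

lemma sum_mult_le_prod:
  fixes t U :: "'a \<Rightarrow> real"
  assumes "finite A" "\<And>i. i \<in> A \<Longrightarrow> 0 \<le> U i" "\<And>i. i \<in> A \<Longrightarrow> 0 \<le> t i"
    and "\<And>j. j \<in> A \<Longrightarrow> t j \<le> Q + (\<Sum>i\<in>{i\<in>A. t i < t j}. U i * t i)"
  shows "Q + (\<Sum>i\<in>A. U i * t i) \<le> Q * (\<Prod>i\<in>A. 1 + U i)"
  using assms
proof (induction A rule: finite_remove_induct)
  case empty
  then show ?case by simp
next
  case (remove A)
  have "Max (t ` A) \<in> t ` A" using remove by (intro Max_in) auto
  then obtain j where j: "j \<in> A" and "t j = Max (t ` A)" by auto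
  then have maxj: "t i \<le> t j" if "i \<in> A" for i
    using that remove by simp
  let ?B = "A - {j}"
  have IH: "Q + (\<Sum>i\<in>?B. U i * t i) \<le> Q * (\<Prod>i\<in>?B. 1 + U i)"
  proof (rule remove.IH[OF j])
    fix i assume i: "i \<in> ?B"
    \<comment> \<open>Because the comparison is strict, a maximal \<open>j\<close> precedes no
      index, even when there are ties.\<close>
    have "{l \<in> ?B. t l < t i} = {l \<in> A. t l < t i}" using maxj[of i] i by auto
    then show "t i \<le> Q + (\<Sum>l\<in>{l \<in> ?B. t l < t i}. U l * t l)" using remove.prems(3)[of i] i by simp
  qed (use remove.prems in auto)
  have "(\<Sum>i\<in>{i \<in> A. t i < t j}. U i * t i) \<le> (\<Sum>i\<in>?B. U i * t i)"
    using remove by (intro sum_mono2) auto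
  then have "t j \<le> Q + (\<Sum>i\<in>?B. U i * t i)" using remove.prems(3)[OF j] by linarith
  then have "U j * t j \<le> U j * (Q + (\<Sum>i\<in>?B. U i * t i))"
    using remove.prems(1)[OF j] by (intro mult_left_mono)
  then have "Q + (\<Sum>i\<in>A. U i * t i) \<le> (1 + U j) * (Q + (\<Sum>i\<in>?B. U i * t i))"
    using sum.remove[OF remove.hyps(1) j, of "\<lambda>i. U i * t i"] by (simp add: algebra_simps)
  also have "\<dots> \<le> (1 + U j) * (Q * (\<Prod>i\<in>?B. 1 + U i))"
    using IH remove.prems(1)[OF j] by (intro mult_left_mono) auto
  also have "\<dots> = Q * (\<Prod>i\<in>A. 1 + U i)"
    using prod.remove[OF remove.hyps(1) j, of "\<lambda>i. 1 + U i"] by simp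
  finally show ?case .
qed

text \<open>The maximum with 1 covers the tasks of period at least \<open>D\<close>, which have one job to finish by
  time \<open>D\<close> because their deadlines are at most \<open>D\<close>.\<close>

definition jobs_due :: "real \<Rightarrow> real \<Rightarrow> nat" where
  "jobs_due D T = max 1 (nat (\<lceil>D / T\<rceil> - 1))"

text \<open>Up to time \<open>D\<close> the ceiling exceeds \<open>jobs_due D T\<close> by at most
  one, and that extra job can appear only after the instant \<open>jobs_due D T * T\<close>.\<close>

lemma ceiling_le_jobs_due:
  fixes t T D :: real
  assumes "0 < T" "t \<le> D"
  shows "real_of_int \<lceil>t / T\<rceil> \<le> real (jobs_due D T) + (if jobs_due D T * T < t then 1 else 0)"
proof -
  have "\<lceil>t / T\<rceil> \<le> \<lceil>D / T\<rceil>" using assms by (intro ceiling_mono divide_right_mono) auto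
  also have "\<dots> \<le> int (jobs_due D T) + 1" unfolding jobs_due_def by linarith
  finally have 1: "\<lceil>t / T\<rceil> \<le> int (jobs_due D T) + 1" .
  have 2: "\<lceil>t / T\<rceil> \<le> int (jobs_due D T)" if "t \<le> jobs_due D T * T"
    using that assms by (simp add: ceiling_le_iff field_simps)
  show ?thesis
  proof (cases "jobs_due D T * T < t")
    case True
    then show ?thesis using 1 by simp
  next
    case False
    then have "\<lceil>t / T\<rceil> \<le> int (jobs_due D T)" using 2 by simp
    then have "real_of_int \<lceil>t / T\<rceil> \<le> real (jobs_due D T)" by linarith
    then show ?thesis using False by simp
  qed
qed

text \<open>A single job is due at \<open>d\<close>. If several jobs are counted, then
  \<open>jobs_due D T * T \<le> D\<close>, and the last of them is due by the end of its
  period.\<close>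

lemma jobs_due_deadline:
  assumes "0 < T" "d \<le> T" "d \<le> D"
  shows "(real (jobs_due D T) - 1) * T + d \<le> D"
proof (cases "jobs_due D T = 1")
  case True
  then show ?thesis using assms by simp
next
  case False
  then have "int (jobs_due D T) = \<lceil>D / T\<rceil> - 1" unfolding jobs_due_def by linarith
  then have "real (jobs_due D T) \<le> D / T" by linarith
  then have "real (jobs_due D T) * T \<le> D" using assms by (simp add: field_simps)
  then show ?thesis using assms by (simp add: algebra_simps)
qed

lemma tda_test_failure:
  assumes fail: "\<not> tda_test \<tau> S k" and "finite S"
    and D: "0 < deadline (\<tau> k)" and "0 < wcet (\<tau> k)"
    and pos: "\<And>i. i \<in> S \<Longrightarrow> 0 < wcet (\<tau> i) \<and> 0 < period (\<tau> i)"
  defines "Q \<equiv> wcet (\<tau> k) + (\<Sum>i\<in>S. real (jobs_due (deadline (\<tau> k)) (period (\<tau> i))) * wcet (\<tau> i))"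
  shows "deadline (\<tau> k) * exp (- (\<Sum>i\<in>S. wcet (\<tau> i) / period (\<tau> i))) < Q"
proof -
  let ?D = "deadline (\<tau> k)"
  let ?C = "\<lambda>i. wcet (\<tau> i)"
  let ?T = "\<lambda>i. period (\<tau> i)"
  let ?U = "\<lambda>i. ?C i / ?T i"
  let ?n = "\<lambda>i. real (jobs_due ?D (?T i))"
  define t where "t i = ?n i * ?T i" for i
  have n1: "1 \<le> ?n i" for i by (simp add: jobs_due_def)
  have tpos: "0 < t i" if "i \<in> S" for i
    using pos[OF that] n1[of i] unfolding t_def by (intro mult_pos_pos) auto
  \<comment> \<open>Failure at \<open>x\<close> bounds \<open>x\<close> by \<open>Q\<close> plus one
    extra job for each task with \<open>t i < x\<close>; such a job costs
    \<open>?C i = ?U i * period (\<tau> i)\<close>, which is at most \<open>?U i * t i\<close> since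
    \<open>?n i \<ge> 1\<close>.\<close>
  have demand: "x < Q + (\<Sum>i\<in>{i\<in>S. t i < x}. ?U i * t i)" if x: "0 < x" "x \<le> ?D" for x
  proof -
    have "x < ?C k + (\<Sum>i\<in>S. real_of_int \<lceil>x / ?T i\<rceil> * ?C i)"
      using fail x by (auto simp: tda_test_def not_le)
    also have "(\<Sum>i\<in>S. real_of_int \<lceil>x / ?T i\<rceil> * ?C i)
        \<le> (\<Sum>i\<in>S. ?n i * ?C i + (if t i < x then ?U i * t i else 0))"
    proof (rule sum_mono)
      fix i assume i: "i \<in> S"
      have "real_of_int \<lceil>x / ?T i\<rceil> * ?C i \<le> (?n i + (if t i < x then 1 else 0)) * ?C i"
        using ceiling_le_jobs_due[of "?T i" x ?D] pos[OF i] x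
        unfolding t_def by (intro mult_right_mono) auto
      moreover have "1 * ?C i \<le> ?U i * t i"
        using pos[OF i] n1[of i] by (simp add: t_def)
      ultimately show "real_of_int \<lceil>x / ?T i\<rceil> * ?C i
          \<le> ?n i * ?C i + (if t i < x then ?U i * t i else 0)"
        by (auto simp: algebra_simps)
    qed
    also have "\<dots> = (\<Sum>i\<in>S. ?n i * ?C i) + (\<Sum>i\<in>{i\<in>S. t i < x}. ?U i * t i)"
      using \<open>finite S\<close> by (simp add: sum.distrib sum.If_cases Int_def)
    finally show ?thesis by (simp add: Q_def add.assoc)
  qed
  \<comment> \<open>Exactly these tasks contribute an extra job at \<open>?D\<close>, and their
    instants \<open>t i\<close> lie in the range where the test is known to fail.\<close>
  define A where "A = {i \<in> S. t i < ?D}"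
  have finA: "finite A" using \<open>finite S\<close> by (simp add: A_def)
  have Q0: "0 \<le> Q" unfolding Q_def
    using pos \<open>0 < wcet (\<tau> k)\<close> by (intro add_nonneg_nonneg sum_nonneg) (auto simp: less_imp_le)
  have "?D < Q + (\<Sum>i\<in>A. ?U i * t i)" using demand[OF D] by (simp add: A_def)
  also have "\<dots> \<le> Q * (\<Prod>i\<in>A. 1 + ?U i)"
  proof (rule sum_mult_le_prod[OF finA])
    fix j assume j: "j \<in> A"
    then show "0 \<le> ?U j" "0 \<le> t j" using pos tpos by (auto simp: A_def less_imp_le)
    have "{i \<in> A. t i < t j} = {i \<in> S. t i < t j}" using j by (auto simp: A_def)
    then show "t j \<le> Q + (\<Sum>i\<in>{i \<in> A. t i < t j}. ?U i * t i)"
      using demand[of "t j"] tpos j by (simp add: A_def less_imp_le)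
  qed
  \<comment> \<open>Uses \<open>1 + u \<le> exp u\<close>, which turns the product into the
    exponential of a utilization.\<close>
  also have "\<dots> \<le> Q * (\<Prod>i\<in>A. exp (?U i))"
    using Q0 pos by (intro mult_left_mono prod_mono) (auto simp: A_def less_imp_le intro: add_nonneg_nonneg)
  also have "(\<Prod>i\<in>A. exp (?U i)) = exp (\<Sum>i\<in>A. ?U i)" using finA by (simp add: exp_sum)
  also have "Q * exp (\<Sum>i\<in>A. ?U i) \<le> Q * exp (\<Sum>i\<in>S. ?U i)"
    using Q0 pos \<open>finite S\<close> unfolding A_def
    by (intro mult_left_mono) (auto intro!: sum_mono2 simp: less_imp_le)
  finally show ?thesis by (simp add: exp_minus field_simps)
qed

section \<open>The partitioning algorithm\<close>

text \<open>Lets sums over the processors be merged into one sum over tasks, each counted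
  once.\<close>

lemma dm_partition_disjoint:
  assumes "dm_partition M test fit k = Some P"
  shows "(\<forall>m. P m \<subseteq> {1..k}) \<and> disjoint_family P"
  using assms
proof (induction M test fit k arbitrary: P rule: dm_partition.induct)
  case (3 M test fit k)
  from "3.prems" obtain P' m where P': "dm_partition M test fit (Suc k) = Some P'"
      "P = P'(m := insert (Suc (Suc k)) (P' m))"
    by (auto simp: Let_def split: option.splits if_splits)
  have "(\<forall>m. P' m \<subseteq> {1..Suc k}) \<and> disjoint_family P'" using "3.IH" P'(1) by blast
  then have sub: "P' l \<subseteq> {1..Suc k}" and dis: "l \<noteq> l' \<Longrightarrow> P' l \<inter> P' l' = {}" for l l'
    by (auto simp: disjoint_family_on_def)
  have new: "Suc (Suc k) \<notin> P' l" for l using sub[of l] by auto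
  have "P l \<subseteq> {1..Suc (Suc k)}" for l using sub[of l] by (auto simp: P'(2))
  moreover have "disjoint_family P"
    using dis new by (auto simp: P'(2) disjoint_family_on_def)
  ultimately show ?case by blast
qed (auto simp: disjoint_family_on_def)

text \<open>Failure is passed on unchanged, so it can be traced back to the task that no processor
  accepted, together with the partition at that moment.\<close>

lemma dm_partition_failure:
  assumes "dm_partition M test fit N = None"
  obtains k P where "Suc k \<le> N" "dm_partition M test fit k = Some P"
    "\<And>m. m \<in> {1..M} \<Longrightarrow> \<not> test (P m) (Suc k)"
proof -
  have "\<exists>k P. Suc k \<le> N \<and> dm_partition M test fit k = Some P \<and> (\<forall>m\<in>{1..M}. \<not> test (P m) (Suc k))"
    using assms
  proof (induction M test fit N rule: dm_partition.induct)
    case (3 M test fit k)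
    show ?case
    proof (cases "dm_partition M test fit (Suc k)")
      case None
      then show ?thesis using "3.IH" by (meson le_Suc_eq)
    next
      case (Some P)
      then have "{m \<in> {1..M}. test (P m) (Suc (Suc k))} = {}"
        using "3.prems" by (auto simp: Let_def split: if_splits)
      then show ?thesis using Some by blast
    qed
  qed auto
  then show thesis using that by blast
qed

text \<open>The condition on \<open>s\<close> says \<open>2 * s \<le> exp (- s)\<close>. Summing the
  rejection bounds gives the opposite strict inequality: one \<open>s\<close> comes from the wcet of
  the rejected task, the other from the demand up to its deadline.\<close>

lemma dm_partition_failure_infeasible:
  assumes "1 \<le> M" and sp: "sporadic_task_set N \<tau>" and cd: "constrained_deadlines N \<tau>"
    and dm: "deadline_monotonic_indexing N \<tau>"
    and fail: "dm_partition M (tda_test \<tau>) fit N = None"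
    and s: "0 < s" "s * exp s \<le> 1 / 2"
  shows "\<not> feasible M s N \<tau>"
proof
  assume feas: "feasible M s N \<tau>"
  obtain k' P where k': "Suc k' \<le> N" "dm_partition M (tda_test \<tau>) fit k' = Some P"
      and rej: "\<And>m. m \<in> {1..M} \<Longrightarrow> \<not> tda_test \<tau> (P m) (Suc k')"
    using dm_partition_failure[OF fail] by metis
  define k where "k = Suc k'"
  have sub: "P m \<subseteq> {1..k'}" for m using dm_partition_disjoint[OF k'(2)] by blast
  have disj: "disjoint_family P" using dm_partition_disjoint[OF k'(2)] by blast
  have fin: "finite (P m)" for m using sub[of m] finite_subset by blast
  have k: "k \<in> {1..N}" using k'(1) by (simp add: k_def)
  have inN: "i \<in> {1..N} \<and> i \<noteq> k \<and> i \<le> k" if "i \<in> P m" for i m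
    using sub[of m] that k'(1) by (auto simp: k_def)
  have pos: "0 < wcet (\<tau> i)" "0 < period (\<tau> i)" "0 < deadline (\<tau> i)" "deadline (\<tau> i) \<le> period (\<tau> i)"
    if "i \<in> {1..N}" for i
    using sp cd that by (auto simp: sporadic_task_set_def constrained_deadlines_def)
  let ?C = "\<lambda>i. wcet (\<tau> i)"
  let ?U = "\<lambda>i. ?C i / period (\<tau> i)"
  let ?D = "deadline (\<tau> k)"
  let ?n = "\<lambda>i. jobs_due ?D (period (\<tau> i))"
  define B where "B = (\<Union>m\<in>{1..M}. P m)"
  have BN: "B \<subseteq> {1..N}" "k \<notin> B" and Bk: "\<And>i. i \<in> B \<Longrightarrow> i \<le> k" using inN by (auto simp: B_def)
  have sumB: "(\<Sum>m\<in>{1..M}. \<Sum>i\<in>P m. f i) = (\<Sum>i\<in>B. f i)" for f :: "nat \<Rightarrow> real"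
    unfolding B_def using disj fin by (intro sum.UNION_disjoint[symmetric]) (auto simp: disjoint_family_on_def)
  have D: "0 < ?D" using pos k by blast
  have util: "(\<Sum>i\<in>B. ?U i) \<le> real M * s"
  proof -
    have "(\<Sum>i\<in>B. ?U i) \<le> (\<Sum>i\<in>{1..N}. ?U i)"
      using BN pos by (intro sum_mono2) (auto simp: less_imp_le)
    then show ?thesis using feasible_utilization_le[OF feas sp cd s(1)] by linarith
  qed
  have demand: "?C k + (\<Sum>i\<in>B. real (?n i) * ?C i) \<le> real M * s * ?D"
  proof -
    \<comment> \<open>One job of the rejected task, the jobs due of every task already placed, and
      none of the others.\<close>
    define n where "n i = (if i = k then 1 else if i \<in> B then ?n i else 0)" for i
    have "?C k + (\<Sum>i\<in>B. real (?n i) * ?C i) = (\<Sum>i\<in>insert k B. real (n i) * ?C i)"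
    proof -
      have "(\<Sum>i\<in>B. real (?n i) * ?C i) = (\<Sum>i\<in>B. real (n i) * ?C i)"
        using BN by (intro sum.cong) (auto simp: n_def)
      then show ?thesis
        using BN finite_subset[OF BN(1)] by (simp add: n_def)
    qed
    also have "\<dots> = (\<Sum>i\<in>{1..N}. real (n i) * ?C i)"
      using BN k by (intro sum.mono_neutral_left) (auto simp: n_def)
    also have "\<dots> \<le> real M * s * ?D"
    proof (rule feasible_demand_le[OF feas sp s(1)])
      fix i assume i: "i \<in> {1..N}" "0 < n i"
      show "(real (n i) - 1) * period (\<tau> i) + deadline (\<tau> i) \<le> ?D"
      proof (cases "i = k")
        case False
        then have iB: "i \<in> B" "n i = ?n i" using i(2) by (auto simp: n_def split: if_splits)
        have "deadline (\<tau> i) \<le> ?D"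
          using dm i(1) k Bk[OF iB(1)] by (auto simp: deadline_monotonic_indexing_def)
        then show ?thesis using jobs_due_deadline pos[OF i(1)] iB(2) by simp
      qed (simp add: n_def)
    qed (use D in simp)
    finally show ?thesis .
  qed
  have Ck: "?C k \<le> s * ?D" by (rule feasible_wcet_le[OF feas sp s(1) k])
  \<comment> \<open>Jensen's inequality for \<open>exp\<close>, by way of its tangent at \<open>- s\<close>.\<close>
  have "real M * exp (- s) \<le> exp (- s) * (real M + (real M * s - (\<Sum>i\<in>B. ?U i)))"
    using util by (simp add: algebra_simps)
  also have "\<dots> = (\<Sum>m\<in>{1..M}. exp (- s) * (1 + (s - (\<Sum>i\<in>P m. ?U i))))"
    by (simp add: sum_distrib_left[symmetric] sum.distrib sum_subtractf sumB del: One_nat_def)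
  also have "\<dots> \<le> (\<Sum>m\<in>{1..M}. exp (- s) * exp (s - (\<Sum>i\<in>P m. ?U i)))"
    by (intro sum_mono mult_left_mono exp_ge_add_one_self) auto
  finally have "real M * exp (- s) \<le> (\<Sum>m\<in>{1..M}. exp (- (\<Sum>i\<in>P m. ?U i)))"
    by (simp add: exp_add[symmetric])
  then have "?D * (real M * exp (- s)) \<le> ?D * (\<Sum>m\<in>{1..M}. exp (- (\<Sum>i\<in>P m. ?U i)))"
    using D by (intro mult_left_mono) auto
  also have "\<dots> = (\<Sum>m\<in>{1..M}. ?D * exp (- (\<Sum>i\<in>P m. ?U i)))" by (rule sum_distrib_left)
  also have "\<dots> < (\<Sum>m\<in>{1..M}. ?C k + (\<Sum>i\<in>P m. real (?n i) * ?C i))"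
  proof (rule sum_strict_mono)
    fix m assume m: "m \<in> {1..M}"
    show "?D * exp (- (\<Sum>i\<in>P m. ?U i)) < ?C k + (\<Sum>i\<in>P m. real (?n i) * ?C i)"
      using tda_test_failure[of \<tau> "P m" k] rej[OF m] fin D pos inN k by (auto simp: k_def)
  qed (use assms(1) in auto)
  \<comment> \<open>Each of the \<open>M\<close> processors rejects task \<open>k\<close>, so its
    wcet occurs \<open>M\<close> times; the bound \<open>demand\<close> covers only the sum over
    \<open>B\<close>, hence the separate estimate \<open>Ck\<close>.\<close>
  also have "\<dots> = real M * ?C k + (\<Sum>i\<in>B. real (?n i) * ?C i)"
    by (simp add: sum.distrib sumB del: One_nat_def)
  also have "\<dots> \<le> real M * ?C k + real M * s * ?D"
    using demand pos(1)[OF k] by linarith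
  also have "\<dots> \<le> real M * (s * ?D) + real M * s * ?D"
    using Ck by (intro add_right_mono mult_left_mono) auto
  also have "\<dots> = ?D * (real M * (2 * s))" by simp
  finally have "exp (- s) < 2 * s" using D assms(1) by simp
  then show False using s(2) by (simp add: exp_minus field_simps)
qed

theorem theorem6:
  fixes M N :: nat and \<tau> :: "nat \<Rightarrow> task" and fit :: strategy
  assumes "1 \<le> M"
    and "sporadic_task_set N \<tau>"
    and "constrained_deadlines N \<tau>"
    and "deadline_monotonic_indexing N \<tau>"
    and "fitting_strategy fit"
  shows "(dm_partition M (tda_test \<tau>) fit N = None \<longrightarrow> \<not> feasible M (lambert_W (1 / 2)) N \<tau>)
    \<and> \<bar>1 / lambert_W (1 / 2) - 2.84306\<bar> \<le> 5 / 10 ^ 6"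
proof
  have pos: "0 < lambert_W (1 / 2)" by (rule less_le_trans[OF _ lambert_W_half(2)]) simp
  show "dm_partition M (tda_test \<tau>) fit N = None \<longrightarrow> \<not> feasible M (lambert_W (1 / 2)) N \<tau>"
    using dm_partition_failure_infeasible[OF assms(1-4) _ pos] lambert_W_half(1) by simp
  \<comment> \<open>The two decimals are \<open>2.84306 - 5 / 10^6\<close> and
    \<open>2.84306 + 5 / 10^6\<close>.\<close>
  have "2.843055 * lambert_W (1 / 2) \<le> 1" "1 \<le> 2.843065 * lambert_W (1 / 2)"
    using lambert_W_half(2,3) by simp_all
  then have "2.843055 \<le> 1 / lambert_W (1 / 2)" "1 / lambert_W (1 / 2) \<le> 2.843065"
    unfolding pos_le_divide_eq[OF pos] pos_divide_le_eq[OF pos] .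
  then have "1 / lambert_W (1 / 2) - 2.84306 \<le> 5 / 10 ^ 6"
    "- (1 / lambert_W (1 / 2) - 2.84306) \<le> 5 / 10 ^ 6" by simp_all
  then show "\<bar>1 / lambert_W (1 / 2) - 2.84306\<bar> \<le> 5 / 10 ^ 6"
    by (rule abs_leI)
qed

end
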